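(* There exists a positive operator $T\colon c_0\to c_0$ with $\|T^n\|\le 4$ for every $n\in\mathbb{N}$ such that all powers $T^m$, $m\in\mathbb{N}=\{1,2,3,\dots\}$, of $T$ are mean ergodic but $T$ is not weakly almost periodic.
   Context: "Operator" means linear operator. $c_0$ is the Banach lattice of real null sequences indexed by $\mathbb{N}$, with the supremum norm and the coordinatewise order. An operator is positive if it maps the positive cone into itself. A bounded linear operator $T$ on a Banach space $X$ is called mean ergodic if the limit $\lim_{n\to\infty}\frac{1}{n}\sum_{k=0}^{n-1}T^k x$ exists (in norm) for every $x\in X$. It is called weakly almost periodic if $\{T^n x : n\in\mathbb{N}\}$ is relatively weakly compact in $X$ for every $x\in X$. *)

theory Defs
  imports "HOL-Analysis.Analysis"
begin

section \<open>The Banach lattice of real null sequences\<close>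

typedef c0 = "{f :: nat \<Rightarrow> real. f \<longlonglongrightarrow> 0}"
  morphisms c0_nth Abs_c0
  by (intro exI[of _ "\<lambda>_. 0"]) simp

setup_lifting type_definition_c0

lemma c0_nth_tendsto: "c0_nth x \<longlonglongrightarrow> 0"
  using c0_nth[of x] by simp

lemma c0_eqI: "(\<And>n. c0_nth x n = c0_nth y n) \<Longrightarrow> x = y"
  by (simp add: c0_nth_inject[symmetric] ext)

instantiation c0 :: real_vector
begin

lift_definition zero_c0 :: c0 is "\<lambda>_. 0" by simp

lift_definition plus_c0 :: "c0 \<Rightarrow> c0 \<Rightarrow> c0" is "\<lambda>f g n. f n + g n"
  by (auto intro: tendsto_add_zero)

lift_definition minus_c0 :: "c0 \<Rightarrow> c0 \<Rightarrow> c0" is "\<lambda>f g n. f n - g n"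
  using tendsto_diff by fastforce

lift_definition uminus_c0 :: "c0 \<Rightarrow> c0" is "\<lambda>f n. - f n"
  using tendsto_minus by fastforce

lift_definition scaleR_c0 :: "real \<Rightarrow> c0 \<Rightarrow> c0" is "\<lambda>a f n. a * f n"
  by (auto intro: tendsto_mult_right_zero)

instance
  by standard (transfer, simp add: algebra_simps fun_eq_iff)+

end

lemma c0_nth_simps [simp]:
  "c0_nth 0 n = 0"
  "c0_nth (x + y) n = c0_nth x n + c0_nth y n"
  "c0_nth (x - y) n = c0_nth x n - c0_nth y n"
  "c0_nth (- x) n = - c0_nth x n"
  "c0_nth (a *\<^sub>R x) n = a * c0_nth x n"
  by (transfer, simp)+

lemma bdd_above_c0_nth: "bdd_above (range (\<lambda>n. \<bar>c0_nth x n\<bar>))"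
proof -
  have "Bseq (c0_nth x)"
    using c0_nth_tendsto[of x] by (intro convergent_imp_Bseq convergentI)
  then show ?thesis
    by (auto simp: Bseq_def bdd_above_def)
qed

instantiation c0 :: real_normed_vector
begin

definition norm_c0 :: "c0 \<Rightarrow> real"
  where "norm_c0 x = (SUP n. \<bar>c0_nth x n\<bar>)"

definition dist_c0 :: "c0 \<Rightarrow> c0 \<Rightarrow> real"
  where "dist_c0 x y = norm (x - y)"

definition sgn_c0 :: "c0 \<Rightarrow> c0"
  where "sgn_c0 x = x /\<^sub>R norm x"

definition uniformity_c0 :: "(c0 \<times> c0) filter"
  where "uniformity_c0 = (INF e\<in>{0 <..}. principal {(x, y). dist x y < e})"

definition open_c0 :: "c0 set \<Rightarrow> bool"
  where "open_c0 S = (\<forall>x\<in>S. \<forall>\<^sub>F (x', y) in uniformity. x' = x \<longrightarrow> y \<in> S)"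

lemma abs_c0_nth_le_norm: "\<bar>c0_nth x n\<bar> \<le> norm x"
  unfolding norm_c0_def by (rule cSUP_upper[OF _ bdd_above_c0_nth]) simp

lemma norm_c0_leI: "(\<And>n. \<bar>c0_nth x n\<bar> \<le> b) \<Longrightarrow> norm x \<le> b" for x :: c0
  unfolding norm_c0_def by (rule cSUP_least) auto

instance
proof
  fix x y :: c0 and a :: real
  show "dist x y = norm (x - y)" by (rule dist_c0_def)
  show "sgn x = x /\<^sub>R norm x" by (rule sgn_c0_def)
  show "(uniformity :: (c0 \<times> c0) filter) = (INF e\<in>{0 <..}. principal {(x, y). dist x y < e})"
    by (rule uniformity_c0_def)
  show "open S = (\<forall>x\<in>S. \<forall>\<^sub>F (x', y) in uniformity. x' = x \<longrightarrow> y \<in> S)" for S :: "c0 set"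
    by (rule open_c0_def)
  show "norm x = 0 \<longleftrightarrow> x = 0"
  proof
    assume "norm x = 0"
    then have "c0_nth x n = 0" for n
      using abs_c0_nth_le_norm[of x n] by simp
    then show "x = 0" by (intro c0_eqI) simp
  qed (simp add: norm_c0_def)
  show "norm (x + y) \<le> norm x + norm y"
  proof (rule norm_c0_leI)
    fix n
    show "\<bar>c0_nth (x + y) n\<bar> \<le> norm x + norm y"
      using abs_c0_nth_le_norm[of x n] abs_c0_nth_le_norm[of y n] by simp
  qed
  have le: "norm (a *\<^sub>R x) \<le> \<bar>a\<bar> * norm x" for a :: real and x :: c0
    by (rule norm_c0_leI) (simp add: abs_mult mult_left_mono abs_c0_nth_le_norm)
  show "norm (a *\<^sub>R x) = \<bar>a\<bar> * norm x"
  proof (cases "a = 0")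
    case True
    then show ?thesis by (simp add: norm_c0_def)
  next
    case False
    have "\<bar>a\<bar> * norm x \<le> norm (a *\<^sub>R x)"
      using le[of "inverse a" "a *\<^sub>R x"] False by (simp add: field_simps)
    with le[of a x] show ?thesis by simp
  qed
qed

end

instance c0 :: banach
proof
  fix X :: "nat \<Rightarrow> c0"
  assume X: "Cauchy X"
  have coord: "\<bar>c0_nth x n - c0_nth y n\<bar> \<le> dist x y" for x y n
    using abs_c0_nth_le_norm[of "x - y" n] by (simp add: dist_norm)
  have "Cauchy (\<lambda>k. c0_nth (X k) n)" for n
  proof (rule metric_CauchyI)
    fix e :: real assume "0 < e"
    then obtain M where "\<forall>i\<ge>M. \<forall>j\<ge>M. dist (X i) (X j) < e"
      using metric_CauchyD[OF X] by blast
    then show "\<exists>M. \<forall>i\<ge>M. \<forall>j\<ge>M. dist (c0_nth (X i) n) (c0_nth (X j) n) < e"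
      by (metis coord dist_real_def order_le_less_trans)
  qed
  then have "\<exists>l. (\<lambda>k. c0_nth (X k) n) \<longlonglongrightarrow> l" for n
    by (simp add: Cauchy_convergent_iff convergent_def)
  then obtain L where L: "\<And>n. (\<lambda>k. c0_nth (X k) n) \<longlonglongrightarrow> L n"
    by metis
  have unif: "\<exists>M. \<forall>i\<ge>M. \<forall>n. \<bar>c0_nth (X i) n - L n\<bar> \<le> e" if e: "0 < e" for e
  proof -
    obtain M where M: "\<forall>i\<ge>M. \<forall>j\<ge>M. dist (X i) (X j) < e"
      using metric_CauchyD[OF X e] by blast
    have "\<bar>c0_nth (X i) n - L n\<bar> \<le> e" if "i \<ge> M" for i n
    proof (rule LIMSEQ_le_const2)
      show "(\<lambda>j. \<bar>c0_nth (X i) n - c0_nth (X j) n\<bar>) \<longlonglongrightarrow> \<bar>c0_nth (X i) n - L n\<bar>"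
        by (intro tendsto_intros L)
      show "\<exists>N. \<forall>j\<ge>N. \<bar>c0_nth (X i) n - c0_nth (X j) n\<bar> \<le> e"
        using M that coord by (meson less_eq_real_def order_trans)
    qed
    then show ?thesis by blast
  qed
  have "L \<longlonglongrightarrow> 0"
  proof (rule LIMSEQ_I)
    fix e :: real assume e: "0 < e"
    obtain i where i: "\<And>n. \<bar>c0_nth (X i) n - L n\<bar> \<le> e / 2"
      using unif[of "e / 2"] e by auto
    obtain N where N: "\<And>n. n \<ge> N \<Longrightarrow> \<bar>c0_nth (X i) n\<bar> < e / 2"
      using LIMSEQ_D[OF c0_nth_tendsto[of "X i"], of "e / 2"] e by auto
    have "norm (L n - 0) < e" if "n \<ge> N" for n
      using i[of n] N[OF that] unfolding real_norm_def diff_zero by linarith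
    then show "\<exists>N. \<forall>n\<ge>N. norm (L n - 0) < e" by blast
  qed
  then have nth: "c0_nth (Abs_c0 L) = L"
    by (simp add: Abs_c0_inverse)
  have "X \<longlonglongrightarrow> Abs_c0 L"
  proof (rule metric_LIMSEQ_I)
    fix e :: real assume e: "0 < e"
    obtain M where M: "\<And>i n. i \<ge> M \<Longrightarrow> \<bar>c0_nth (X i) n - L n\<bar> \<le> e / 2"
      using unif[of "e / 2"] e by auto
    have "dist (X i) (Abs_c0 L) < e" if "i \<ge> M" for i
    proof -
      have "norm (X i - Abs_c0 L) \<le> e / 2"
        by (rule norm_c0_leI) (use M[OF that] in \<open>simp add: nth\<close>)
      then show ?thesis using e by (simp add: dist_norm)
    qed
    then show "\<exists>M. \<forall>i\<ge>M. dist (X i) (Abs_c0 L) < e" by blast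
  qed
  then show "convergent X" by (rule convergentI)
qed

instantiation c0 :: "{ordered_real_vector, lattice}"
begin

lift_definition less_eq_c0 :: "c0 \<Rightarrow> c0 \<Rightarrow> bool" is "\<lambda>f g. \<forall>n. f n \<le> g n" .

definition less_c0 :: "c0 \<Rightarrow> c0 \<Rightarrow> bool"
  where "less_c0 x y \<longleftrightarrow> x \<le> y \<and> \<not> y \<le> x"

lift_definition sup_c0 :: "c0 \<Rightarrow> c0 \<Rightarrow> c0" is "\<lambda>f g n. max (f n) (g n)"
  using tendsto_max by fastforce

lift_definition inf_c0 :: "c0 \<Rightarrow> c0 \<Rightarrow> c0" is "\<lambda>f g n. min (f n) (g n)"
  using tendsto_min by fastforce

instance
proof
  fix x y z :: c0 and a b :: real
  show "x < y \<longleftrightarrow> x \<le> y \<and> \<not> y \<le> x" by (rule less_c0_def)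
  show "x \<le> x" by transfer simp
  show "x \<le> y \<Longrightarrow> y \<le> z \<Longrightarrow> x \<le> z" by transfer (meson order_trans)
  show "x \<le> y \<Longrightarrow> y \<le> x \<Longrightarrow> x = y" by transfer (simp add: fun_eq_iff order_antisym)
  show "x \<le> y \<Longrightarrow> z + x \<le> z + y" by transfer simp
  show "x \<le> y \<Longrightarrow> 0 \<le> a \<Longrightarrow> a *\<^sub>R x \<le> a *\<^sub>R y" by transfer (simp add: mult_left_mono)
  show "a \<le> b \<Longrightarrow> 0 \<le> x \<Longrightarrow> a *\<^sub>R x \<le> b *\<^sub>R x" by transfer (simp add: mult_right_mono)
  show "inf x y \<le> x" "inf x y \<le> y" "x \<le> sup x y" "y \<le> sup x y" by (transfer, simp)+
  show "x \<le> y \<Longrightarrow> x \<le> z \<Longrightarrow> x \<le> inf y z" by transfer simp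
  show "y \<le> x \<Longrightarrow> z \<le> x \<Longrightarrow> sup y z \<le> x" by transfer simp
qed

end

lemma norm_c0_mono:
  fixes x y :: c0
  assumes "sup x (- x) \<le> sup y (- y)"
  shows "norm x \<le> norm y"
proof (rule norm_c0_leI)
  fix n
  have "max (c0_nth x n) (- c0_nth x n) \<le> max (c0_nth y n) (- c0_nth y n)"
    using assms by transfer simp
  then show "\<bar>c0_nth x n\<bar> \<le> norm y"
    using abs_c0_nth_le_norm[of y n] by linarith
qed

section \<open>Operators\<close>

definition positive_operator ::
    "('a::ordered_real_vector \<Rightarrow> 'b::ordered_real_vector) \<Rightarrow> bool" where
  "positive_operator T \<longleftrightarrow> linear T \<and> (\<forall>x\<ge>0. T x \<ge> 0)"

definition mean_ergodic :: "('a::banach \<Rightarrow> 'a) \<Rightarrow> bool" where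
  "mean_ergodic T \<longleftrightarrow> bounded_linear T \<and>
     (\<forall>x. convergent (\<lambda>n. (1 / real n) *\<^sub>R (\<Sum>k<n. (T ^^ k) x)))"

definition weak_topology :: "'a::real_normed_vector topology" where
  "weak_topology =
     topology_generated_by {f -` U | (f :: 'a \<Rightarrow> real) U. bounded_linear f \<and> open U}"

lemma topspace_weak_topology [simp]: "topspace weak_topology = UNIV"
proof -
  have "UNIV \<in> {f -` U | (f :: 'a \<Rightarrow> real) U. bounded_linear f \<and> open U}"
    by (rule CollectI, rule exI[of _ "\<lambda>_. 0"], rule exI[of _ UNIV]) simp
  then show ?thesis
    unfolding weak_topology_def topology_generated_by_topspace by blast
qed

definition relatively_weakly_compact :: "'a::real_normed_vector set \<Rightarrow> bool" where
  "relatively_weakly_compact S \<longleftrightarrow> compactin weak_topology (weak_topology closure_of S)"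

definition weakly_almost_periodic :: "('a::banach \<Rightarrow> 'a) \<Rightarrow> bool" where
  "weakly_almost_periodic T \<longleftrightarrow> bounded_linear T \<and>
     (\<forall>x. relatively_weakly_compact {(T ^^ n) x | n. n \<ge> 1})"

end

theory Submission
  imports Defs "HOL-Library.Discrete_Functions"
begin

text \<open>Read dually on unit masses \<open>\<delta>\<close>, row 0 is a delay line: a mass at \<open>(0, j)\<close> moves
  down to \<open>(0, j - 1)\<close> and disappears after \<open>(0, 0)\<close>.  In every row \<open>r > 0\<close> a unit mass runs
  through \<open>(r, 0)\<close>, \<open>(r, 1)\<close>, \<open>\<dots>\<close> forever and, between the squares \<open>k\<^sup>2\<close> and \<open>(k + 1)\<^sup>2\<close> with
  \<open>k \<ge> r\<close>, drops at each step a portion \<open>1 / (2 k + 1)\<close> into the delay line, at the place from which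
  it arrives at \<open>(0, 0)\<close> exactly at time \<open>(k + 1)\<^sup>2\<close>.  So at most mass 1 is in the delay
  line at any time, and the powers have norm at most 2.

  At the times \<open>K\<^sup>2\<close> the orbit of the unit vector at \<open>(0, 0)\<close> is 1 at \<open>(r, 0)\<close> for
  \<open>1 \<le> r < K\<close>, so every weak cluster point of these iterates would be 1 at infinitely many
  places.  On the other hand, a window of \<open>N\<close> consecutive times contains only \<open>O(\<surd>N)\<close> squares,
  so, uniformly in the coordinate, an orbit is not small at only \<open>O(\<surd>N)\<close> of the times below
  \<open>N\<close>.  Hence the Cesaro means of every power tend to 0.\<close>

section \<open>Null sequences on pairs of naturals\<close>

text \<open>This form of convergence to 0 ignores the order of the indices, so it carries over to
  pairs along any bijection.\<close>

lemma tendsto_zero_iff_finite: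
  fixes f :: "nat \<Rightarrow> real"
  shows "f \<longlonglongrightarrow> 0 \<longleftrightarrow> (\<forall>e>0. finite {n. e \<le> \<bar>f n\<bar>})"
  unfolding cofinite_eq_sequentially[symmetric] tendsto_iff eventually_cofinite
  by (simp add: not_less)

definition pair_nth :: "c0 \<Rightarrow> nat \<times> nat \<Rightarrow> real" where
  "pair_nth x p = c0_nth x (prod_encode p)"

text \<open>Meaningful only for \<open>f\<close> vanishing at infinity on pairs; elsewhere
  \<open>Abs_c0\<close> is unspecified.\<close>

definition of_pairs :: "(nat \<times> nat \<Rightarrow> real) \<Rightarrow> c0" where
  "of_pairs f = Abs_c0 (f \<circ> prod_decode)"

lemma finite_pair_nth_ge:
  assumes "0 < e"
  shows "finite {p. e \<le> \<bar>pair_nth x p\<bar>}"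
proof -
  have "finite {n. e \<le> \<bar>c0_nth x n\<bar>}"
    using c0_nth_tendsto[of x] assms by (simp add: tendsto_zero_iff_finite)
  then have "finite (prod_encode -` {n. e \<le> \<bar>c0_nth x n\<bar>})"
    by (rule finite_vimageI) (rule inj_prod_encode)
  then show ?thesis
    by (simp add: pair_nth_def vimage_def)
qed

lemma pair_nth_of_pairs:
  assumes "\<And>e. 0 < e \<Longrightarrow> finite {p. e \<le> \<bar>f p\<bar>}"
  shows "pair_nth (of_pairs f) = f"
proof -
  have "finite {n. e \<le> \<bar>(f \<circ> prod_decode) n\<bar>}" if "0 < e" for e
    using finite_vimageI[OF assms[OF that] inj_prod_decode] by (simp add: vimage_def)
  then have "(f \<circ> prod_decode) \<longlonglongrightarrow> 0"
    by (simp add: tendsto_zero_iff_finite)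
  then show ?thesis
    by (simp add: pair_nth_def of_pairs_def Abs_c0_inverse fun_eq_iff)
qed

lemma pair_nth_simps [simp]:
  "pair_nth 0 p = 0"
  "pair_nth (x + y) p = pair_nth x p + pair_nth y p"
  "pair_nth (a *\<^sub>R x) p = a * pair_nth x p"
  by (simp_all add: pair_nth_def)

lemma pair_nth_sum: "pair_nth (sum f A) p = (\<Sum>a\<in>A. pair_nth (f a) p)"
  by (induction A rule: infinite_finite_induct) simp_all

lemma pair_nth_eqI: "(\<And>p. pair_nth x p = pair_nth y p) \<Longrightarrow> x = y"
  by (rule c0_eqI) (metis pair_nth_def prod_decode_inverse)

lemma c0_nonneg_iff: "0 \<le> x \<longleftrightarrow> (\<forall>p. 0 \<le> pair_nth x p)"
  unfolding pair_nth_def less_eq_c0.rep_eq by (metis c0_nth_simps(1) prod_decode_inverse)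

lemma abs_pair_nth_le_norm: "\<bar>pair_nth x p\<bar> \<le> norm x"
  by (simp add: pair_nth_def abs_c0_nth_le_norm)

lemma norm_le_pair_nth: "(\<And>p. \<bar>pair_nth x p\<bar> \<le> b) \<Longrightarrow> norm x \<le> b"
  by (rule norm_c0_leI) (metis pair_nth_def prod_decode_inverse)

section \<open>The gap to the next square\<close>

text \<open>A portion leaving place \<open>n\<close> lands one step later, hence the distance from
  \<open>Suc n\<close> to the next square; it is 0 at the last \<open>n\<close> before a
  square.\<close>

definition square_gap :: "nat \<Rightarrow> nat" where
  "square_gap n = (Suc (floor_sqrt n))\<^sup>2 - Suc n"

lemma square_gap: "square_gap n + Suc n = (Suc (floor_sqrt n))\<^sup>2"
  using Suc_floor_sqrt_power2_gt[of n] by (simp add: square_gap_def)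

lemma floor_sqrt_eq_iff: "floor_sqrt n = k \<longleftrightarrow> n \<in> {k\<^sup>2..<(Suc k)\<^sup>2}"
  using Suc_floor_sqrt_power2_gt[of n] floor_sqrt_unique[of k n] by auto

lemma floor_sqrt_add_eq_iff: "floor_sqrt (i + n) = floor_sqrt i \<longleftrightarrow> n \<le> square_gap i"
proof -
  have "(floor_sqrt i)\<^sup>2 \<le> i + n"
    using floor_sqrt_power2_le[of i] by linarith
  then show ?thesis
    using square_gap[of i] by (auto simp: floor_sqrt_eq_iff)
qed

text \<open>Between two squares the gap shrinks exactly as fast as the delay line moves, so all
  portions of one block travel together.\<close>

lemma square_gap_diff:
  assumes "n \<le> square_gap i"
  shows "square_gap i - n = square_gap (i + n)"
  using assms floor_sqrt_add_eq_iff[of i n] square_gap[of i] square_gap[of "i + n"] by simp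

section \<open>Counting times close to a square\<close>

lemma card_floor_sqrt_eq: "card {p. floor_sqrt p = k} = 2 * k + 1"
proof -
  have "{p. floor_sqrt p = k} = {k\<^sup>2..<(Suc k)\<^sup>2}"
    using floor_sqrt_eq_iff by blast
  then show ?thesis
    by (simp add: power2_eq_square)
qed

lemma floor_sqrt_add_le: "floor_sqrt (m + n) \<le> floor_sqrt m + floor_sqrt n + 1"
proof (rule ccontr)
  assume "\<not> ?thesis"
  then have "Suc (floor_sqrt m) + Suc (floor_sqrt n) \<le> floor_sqrt (m + n)"
    by simp
  then have "(Suc (floor_sqrt m) + Suc (floor_sqrt n))\<^sup>2 \<le> m + n"
    by (simp only: le_floor_sqrt_iff)
  moreover have "(Suc (floor_sqrt m))\<^sup>2 + (Suc (floor_sqrt n))\<^sup>2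
      \<le> (Suc (floor_sqrt m) + Suc (floor_sqrt n))\<^sup>2"
    by (simp only: power2_sum le_add1)
  ultimately show False
    using Suc_floor_sqrt_power2_gt[of m] Suc_floor_sqrt_power2_gt[of n] by linarith
qed

text \<open>Block index and gap determine the time. A window of length \<open>N\<close> meets at
  most \<open>floor_sqrt N + 2\<close> blocks, each with at most \<open>M\<close> gaps below
  \<open>M\<close>.\<close>

lemma card_square_gap_less:
  "card {n\<in>{..<N}. square_gap (i + n) < M} \<le> (floor_sqrt N + 2) * M" (is "card ?A \<le> _")
proof -
  let ?h = "\<lambda>n. (floor_sqrt (i + n), square_gap (i + n))"
  let ?B = "{floor_sqrt i..floor_sqrt i + floor_sqrt N + 1} \<times> {..<M}"
  have "inj_on ?h ?A"
  proof (rule inj_onI)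
    fix a b assume "?h a = ?h b"
    then show "a = b"
      using square_gap[of "i + a"] square_gap[of "i + b"] by simp
  qed
  moreover have "?h ` ?A \<subseteq> ?B"
  proof (rule image_subsetI)
    fix n assume "n \<in> ?A"
    then have n: "n < N" "square_gap (i + n) < M"
      by auto
    have "floor_sqrt i \<le> floor_sqrt (i + n)" "floor_sqrt (i + n) \<le> floor_sqrt (i + N)"
      using n by (simp_all add: mono_floor_sqrt')
    then show "?h n \<in> ?B"
      using floor_sqrt_add_le[of i N] n by auto
  qed
  ultimately have "card ?A \<le> card ?B"
    by (meson card_inj_on_le finite_SigmaI finite_atLeastAtMost finite_lessThan)
  then show ?thesis
    by simp
qed

section \<open>The operator\<close>

text \<open>The factor \<open>r \<le> floor_sqrt i\<close> makes the weights vanish at infinity on pairs, which keeps the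
  image of a unit vector of row 0 a null sequence.\<close>

definition feed_weight :: "nat \<Rightarrow> nat \<Rightarrow> real" where
  "feed_weight r i = (if r \<le> floor_sqrt i then 1 / (2 * floor_sqrt i + 1) else 0)"

text \<open>The value at \<open>(r, i)\<close> pairs \<open>x\<close> with what a unit mass at
  \<open>(r, i)\<close> becomes in one step; the 0 at \<open>(0, 0)\<close> is the disappearing
  mass.\<close>

definition shift_feed_fun :: "c0 \<Rightarrow> nat \<times> nat \<Rightarrow> real" where
  "shift_feed_fun x = (\<lambda>(r, i).
     if r = 0 then (if i = 0 then 0 else pair_nth x (0, i - 1))
     else pair_nth x (r, Suc i) + feed_weight r i * pair_nth x (0, square_gap i))"

definition shift_feed :: "c0 \<Rightarrow> c0" where
  "shift_feed x = of_pairs (shift_feed_fun x)"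

lemma finite_feed_weight_ge:
  assumes "0 < e"
  shows "finite {p. e \<le> feed_weight (fst p) (snd p)}"
proof -
  obtain K :: nat where K: "1 / e < real K"
    using reals_Archimedean2 by blast
  have "{p. e \<le> feed_weight (fst p) (snd p)} \<subseteq> {..K} \<times> {..(Suc K)\<^sup>2}"
  proof (rule subsetI)
    fix p assume p: "p \<in> {p. e \<le> feed_weight (fst p) (snd p)}"
    obtain r i where ri: "p = (r, i)" by fastforce
    have r: "r \<le> floor_sqrt i" and e: "e \<le> 1 / (2 * floor_sqrt i + 1)"
      using assms p ri by (auto simp: feed_weight_def split: if_splits)
    have "2 * real (floor_sqrt i) + 1 \<le> 1 / e"
      using e assms by (simp add: field_simps)
    then have q: "floor_sqrt i \<le> K"
      using K by linarith
    have "i < (Suc (floor_sqrt i))\<^sup>2"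
      by (rule Suc_floor_sqrt_power2_gt)
    also have "\<dots> \<le> (Suc K)\<^sup>2"
      using q by (intro power_mono) auto
    finally show "p \<in> {..K} \<times> {..(Suc K)\<^sup>2}"
      using q r ri by simp
  qed
  then show ?thesis
    by (rule finite_subset) simp
qed

lemma feed_weight_nonneg: "0 \<le> feed_weight r i"
  by (simp add: feed_weight_def)

lemma pair_nth_shift_feed: "pair_nth (shift_feed x) = shift_feed_fun x"
  unfolding shift_feed_def
proof (rule pair_nth_of_pairs)
  fix e :: real assume e: "0 < e"
  \<comment> \<open>Adding 1 keeps the threshold \<open>e / (2 * b)\<close> positive even for
    \<open>x = 0\<close>.\<close>
  define b where "b = norm x + 1"
  have b: "0 < b" "\<bar>pair_nth x p\<bar> \<le> b" for p
    using abs_pair_nth_le_norm[of x p] norm_ge_zero[of x] by (simp_all add: b_def)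
  let ?A = "{p. e / 2 \<le> \<bar>pair_nth x p\<bar>}"
  let ?W = "{p. e / (2 * b) \<le> feed_weight (fst p) (snd p)}"
  \<comment> \<open>The three sets catch the shift in row 0, the shift in the other rows, and the
    weights too large for \<open>b\<close> to control the feed term.\<close>
  have "{p. e \<le> \<bar>shift_feed_fun x p\<bar>}
      \<subseteq> (\<lambda>(r, i). (r, Suc i)) ` ?A \<union> (\<lambda>(r, i). (r, i - 1)) ` ?A \<union> ?W" (is "_ \<subseteq> ?R")
  proof (rule subsetI)
    fix p assume "p \<in> {p. e \<le> \<bar>shift_feed_fun x p\<bar>}"
    then have le: "e \<le> \<bar>shift_feed_fun x p\<bar>"
      by simp
    obtain r i where p: "p = (r, i)" by fastforce
    show "p \<in> ?R"
    proof (cases "r = 0")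
      case True
      then have "i \<noteq> 0" "(r, i - 1) \<in> ?A"
        using le e by (auto simp: p shift_feed_fun_def split: if_splits)
      then have "p \<in> (\<lambda>(r, i). (r, Suc i)) ` ?A"
        unfolding p by (intro rev_image_eqI[of "(r, i - 1)"]) auto
      then show ?thesis by blast
    next
      case False
      show ?thesis
      proof (cases "(r, Suc i) \<in> ?A \<or> p \<in> ?W")
        case True
        moreover have "p \<in> (\<lambda>(r, i). (r, i - 1)) ` ?A" if "(r, Suc i) \<in> ?A"
          using that unfolding p by (intro rev_image_eqI[of "(r, Suc i)"]) auto
        ultimately show ?thesis by blast
      next
        case small: False
        have "\<bar>feed_weight r i * pair_nth x (0, square_gap i)\<bar> \<le> feed_weight r i * b"
          using b by (simp add: abs_mult feed_weight_nonneg mult_left_mono)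
        also have "\<dots> < e / 2"
          using small b(1) by (simp add: p field_simps)
        finally have "\<bar>shift_feed_fun x p\<bar> < e"
          using small False by (auto simp: p shift_feed_fun_def)
        then show ?thesis
          using le by simp
      qed
    qed
  qed
  moreover have "finite ?R"
    using e b(1) by (intro finite_UnI finite_imageI finite_pair_nth_ge finite_feed_weight_ge) auto
  ultimately show "finite {p. e \<le> \<bar>shift_feed_fun x p\<bar>}"
    by (rule finite_subset)
qed

lemma linear_shift_feed: "linear shift_feed"
  by (rule linearI; rule pair_nth_eqI)
    (auto simp: pair_nth_shift_feed shift_feed_fun_def algebra_simps split: prod.split)

lemma positive_operator_shift_feed: "positive_operator shift_feed"
  unfolding positive_operator_def
  by (auto simp: linear_shift_feed c0_nonneg_iff pair_nth_shift_feed shift_feed_fun_def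
      feed_weight_nonneg)

section \<open>Powers of the operator\<close>

lemma pair_nth_funpow_zero:
  "pair_nth ((shift_feed ^^ n) x) (0, j) = (if n \<le> j then pair_nth x (0, j - n) else 0)"
  by (induction n arbitrary: j) (auto simp: pair_nth_shift_feed shift_feed_fun_def)

text \<open>The mass in the delay line after the steps at places \<open>i\<close> to
  \<open>m\<close>. Only the block of \<open>m\<close> counts: portions of earlier blocks have
  already run out.\<close>

definition feed_coeff :: "nat \<Rightarrow> nat \<Rightarrow> nat \<Rightarrow> real" where
  "feed_coeff r i m = (if r \<le> floor_sqrt m
     then card {p\<in>{i..m}. floor_sqrt p = floor_sqrt m} / (2 * floor_sqrt m + 1) else 0)"

lemma feed_coeff_nonneg: "0 \<le> feed_coeff r i m"
  by (simp add: feed_coeff_def)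

lemma feed_coeff_le_1: "feed_coeff r i m \<le> 1"
proof -
  have "finite {p. floor_sqrt p = floor_sqrt m}"
    by (simp add: floor_sqrt_eq_iff)
  then have "card {p\<in>{i..m}. floor_sqrt p = floor_sqrt m} \<le> 2 * floor_sqrt m + 1"
    unfolding card_floor_sqrt_eq[symmetric] by (intro card_mono) auto
  then show ?thesis
    by (simp add: feed_coeff_def del: of_nat_add of_nat_mult)
qed

lemma feed_coeff_self: "feed_coeff r i i = feed_weight r i"
proof -
  have "{p\<in>{i..i}. floor_sqrt p = floor_sqrt i} = {i}"
    by auto
  then show ?thesis
    by (simp add: feed_coeff_def feed_weight_def)
qed

text \<open>The first step is split off, not the last, because \<open>shift_feed ^^ Suc n\<close>
  unfolds at its outermost application.\<close>

lemma feed_coeff_rec: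
  assumes "i \<le> m"
  shows "feed_coeff r i m
    = feed_coeff r (Suc i) m + (if floor_sqrt m = floor_sqrt i then feed_weight r i else 0)"
proof -
  have "{p\<in>{i..m}. floor_sqrt p = floor_sqrt m}
      = (if floor_sqrt m = floor_sqrt i then insert i {p\<in>{Suc i..m}. floor_sqrt p = floor_sqrt m}
         else {p\<in>{Suc i..m}. floor_sqrt p = floor_sqrt m})"
    using assms by (auto simp: Suc_le_eq order_le_less)
  then show ?thesis
    by (simp add: feed_coeff_def feed_weight_def add_divide_distrib)
qed

text \<open>The first portion still counts after the remaining steps only if \<open>i + n\<close> is
  in the block of \<open>i\<close>; by \<open>square_gap_diff\<close> it then sits where the later
  portions sit.\<close>

lemma pair_nth_funpow_Suc:
  assumes "r \<noteq> 0"
  shows "pair_nth ((shift_feed ^^ Suc n) x) (r, i)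
    = pair_nth x (r, i + Suc n) + feed_coeff r i (i + n) * pair_nth x (0, square_gap (i + n))"
proof (induction n arbitrary: i)
  case 0
  show ?case
    using assms by (simp add: pair_nth_shift_feed shift_feed_fun_def feed_coeff_self)
next
  case (Suc n)
  have "pair_nth ((shift_feed ^^ Suc (Suc n)) x) (r, i)
      = pair_nth ((shift_feed ^^ Suc n) x) (r, Suc i)
        + feed_weight r i * pair_nth ((shift_feed ^^ Suc n) x) (0, square_gap i)"
    using assms unfolding funpow.simps(2)[of "Suc n"] o_apply
    by (simp only: pair_nth_shift_feed) (simp add: shift_feed_fun_def)
  also have "\<dots> = pair_nth x (r, i + Suc (Suc n))
      + (feed_coeff r (Suc i) (i + Suc n)
         + (if floor_sqrt (i + Suc n) = floor_sqrt i then feed_weight r i else 0))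
        * pair_nth x (0, square_gap (i + Suc n))"
    unfolding Suc.IH pair_nth_funpow_zero floor_sqrt_add_eq_iff
    by (simp add: square_gap_diff algebra_simps)
  finally show ?case
    by (simp add: feed_coeff_rec)
qed

lemma abs_pair_nth_funpow_le:
  assumes "r \<noteq> 0"
  shows "\<bar>pair_nth ((shift_feed ^^ Suc n) x) (r, i)\<bar>
    \<le> \<bar>pair_nth x (r, i + Suc n)\<bar> + \<bar>pair_nth x (0, square_gap (i + n))\<bar>"
proof -
  have "\<bar>feed_coeff r i (i + n) * pair_nth x (0, square_gap (i + n))\<bar>
      \<le> 1 * \<bar>pair_nth x (0, square_gap (i + n))\<bar>"
    unfolding abs_mult
    by (intro mult_right_mono) (simp_all add: feed_coeff_nonneg feed_coeff_le_1)
  then show ?thesis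
    unfolding pair_nth_funpow_Suc[OF assms] by linarith
qed

lemma norm_funpow_shift_feed_le: "norm ((shift_feed ^^ n) x) \<le> 2 * norm x"
proof (rule norm_le_pair_nth)
  fix p :: "nat \<times> nat"
  obtain r i where p: "p = (r, i)" by fastforce
  show "\<bar>pair_nth ((shift_feed ^^ n) x) p\<bar> \<le> 2 * norm x"
  proof (cases "r = 0")
    case True
    then show ?thesis
      using abs_pair_nth_le_norm[of x "(0, i - n)"] norm_ge_zero[of x]
      by (auto simp: p pair_nth_funpow_zero)
  next
    case False
    show ?thesis
    proof (cases n)
      case 0
      then show ?thesis
        using abs_pair_nth_le_norm[of x p] by simp
    next
      case (Suc k)
      then show ?thesis
        using abs_pair_nth_funpow_le[OF False, of k x i]
          abs_pair_nth_le_norm[of x "(r, i + Suc k)"]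
          abs_pair_nth_le_norm[of x "(0, square_gap (i + k))"]
        unfolding p Suc by linarith
    qed
  qed
qed

lemma bounded_linear_funpow_shift_feed: "bounded_linear (shift_feed ^^ n)"
proof (intro bounded_linear_intro[where K = 2])
  have "linear (shift_feed ^^ n)"
    by (induction n) (simp_all add: linear_shift_feed linear_compose[unfolded o_def] linear_id[unfolded id_def])
  then show "(shift_feed ^^ n) (x + y) = (shift_feed ^^ n) x + (shift_feed ^^ n) y"
    and "(shift_feed ^^ n) (a *\<^sub>R x) = a *\<^sub>R (shift_feed ^^ n) x" for x y a
    by (simp_all add: linear_add linear_cmul)
  show "norm ((shift_feed ^^ n) x) \<le> norm x * 2" for x
    using norm_funpow_shift_feed_le[of n x] by simp
qed

section \<open>Mean ergodicity of the powers\<close>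

text \<open>\<open>M\<close> bounds the second indices of all entries of \<open>x\<close> of size at
  least \<open>d\<close>, so it depends on neither \<open>p\<close> nor \<open>N\<close>.\<close>

lemma card_large_pair_nth_funpow:
  assumes "0 < d"
  obtains M where "\<And>p N. card {n\<in>{..<N}. 2 * d < \<bar>pair_nth ((shift_feed ^^ n) x) p\<bar>}
    \<le> 1 + M + (floor_sqrt N + 2) * M"
proof -
  have "finite (snd ` {p. d \<le> \<bar>pair_nth x p\<bar>})"
    using assms by (intro finite_imageI finite_pair_nth_ge)
  then obtain M where "\<And>j. j \<in> snd ` {p. d \<le> \<bar>pair_nth x p\<bar>} \<Longrightarrow> j < M"
    using finite_nat_set_iff_bounded by metis
  then have M: "j < M" if "d \<le> \<bar>pair_nth x (r, j)\<bar>" for r j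
    using that by force
  have "card {n\<in>{..<N}. 2 * d < \<bar>pair_nth ((shift_feed ^^ n) x) p\<bar>}
    \<le> 1 + M + (floor_sqrt N + 2) * M" (is "card ?L \<le> _") for p N
  proof -
    obtain r i where p: "p = (r, i)" by fastforce
    show ?thesis
    proof (cases "r = 0")
      case True
      have "?L \<subseteq> {Suc i - M..<Suc i}"
      proof clarify
        fix n assume "2 * d < \<bar>pair_nth ((shift_feed ^^ n) x) p\<bar>"
        then have "n \<le> i" "d \<le> \<bar>pair_nth x (0, i - n)\<bar>"
          using assms True by (auto simp: p pair_nth_funpow_zero split: if_splits)
        then show "n \<in> {Suc i - M..<Suc i}"
          using M[of 0 "i - n"] by auto
      qed
      then have "card ?L \<le> card {Suc i - M..<Suc i}"
        by (intro card_mono) auto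
      then show ?thesis
        by simp
    next
      case False
      let ?S = "{n\<in>{..<N}. square_gap (i + n) < M}"
      \<comment> \<open>Time 0 stands apart since the formula covers positive powers only; the other
        two sets belong to a large entry in row \<open>r\<close> and in row 0.\<close>
      have "?L \<subseteq> {0} \<union> {..<M} \<union> Suc ` ?S"
      proof
        fix n assume n: "n \<in> ?L"
        show "n \<in> {0} \<union> {..<M} \<union> Suc ` ?S"
        proof (cases n)
          case (Suc k)
          have "d \<le> \<bar>pair_nth x (r, i + Suc k)\<bar> \<or> d \<le> \<bar>pair_nth x (0, square_gap (i + k))\<bar>"
            using abs_pair_nth_funpow_le[OF False, of k x i] n unfolding p Suc by simp linarith
          then show ?thesis
            using M[of r "i + Suc k"] M[of 0 "square_gap (i + k)"] n Suc by auto
        qed simp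
      qed
      then have "card ?L \<le> card ({0} \<union> {..<M} \<union> Suc ` ?S)"
        by (intro card_mono) auto
      also have "\<dots> \<le> card ({0::nat} \<union> {..<M}) + card (Suc ` ?S)"
        by (rule card_Un_le)
      also have "\<dots> \<le> (card {0::nat} + card {..<M}) + card ?S"
        by (intro add_mono card_Un_le card_image_le) simp
      also have "\<dots> \<le> 1 + M + (floor_sqrt N + 2) * M"
        using card_square_gap_less[where N = N and i = i and M = M] by simp
      finally show ?thesis .
    qed
  qed
  with that show thesis by blast
qed

lemma norm_cesaro_shift_feed_le:
  assumes "0 < d" "0 < m"
  obtains M where "\<And>N. norm (\<Sum>k<N. (shift_feed ^^ (m * k)) x)
    \<le> 2 * d * N + 2 * norm x * (1 + M + (floor_sqrt (m * N) + 2) * M)"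
proof -
  obtain M where M: "\<And>p N. card {n\<in>{..<N}. 2 * d < \<bar>pair_nth ((shift_feed ^^ n) x) p\<bar>}
    \<le> 1 + M + (floor_sqrt N + 2) * M"
    using card_large_pair_nth_funpow[OF assms(1)] by metis
  have "norm (\<Sum>k<N. (shift_feed ^^ (m * k)) x)
    \<le> 2 * d * N + 2 * norm x * (1 + M + (floor_sqrt (m * N) + 2) * M)" for N
  proof (rule norm_le_pair_nth)
    fix p
    let ?g = "\<lambda>n. \<bar>pair_nth ((shift_feed ^^ n) x) p\<bar>"
    let ?L = "{k\<in>{..<N}. 2 * d < ?g (m * k)}"
    \<comment> \<open>Multiplication by \<open>m\<close> injects the exceptional
      \<open>k < N\<close> into the exceptional times below \<open>m * N\<close>.\<close>
    have "card ?L \<le> card {n\<in>{..<m * N}. 2 * d < ?g n}"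
      using assms(2) by (intro card_inj_on_le[where f = "(*) m"]) (auto simp: inj_on_def)
    then have L: "card ?L \<le> 1 + M + (floor_sqrt (m * N) + 2) * M"
      using M[of "m * N" p] by linarith
    have "\<bar>pair_nth (\<Sum>k<N. (shift_feed ^^ (m * k)) x) p\<bar> \<le> (\<Sum>k<N. ?g (m * k))"
      unfolding pair_nth_sum by (rule sum_abs)
    also have "\<dots> \<le> (\<Sum>k<N. 2 * d + (if k \<in> ?L then 2 * norm x else 0))"
    proof (rule sum_mono)
      fix k assume "k \<in> {..<N}"
      then show "?g (m * k) \<le> 2 * d + (if k \<in> ?L then 2 * norm x else 0)"
        using order_trans[OF abs_pair_nth_le_norm norm_funpow_shift_feed_le, of "m * k" x p] assms(1)
        by auto
    qed
    also have "\<dots> = 2 * d * N + 2 * norm x * card ?L"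
      by (simp add: sum.distrib sum.If_cases Int_def)
    also have "\<dots> \<le> 2 * d * N + 2 * norm x * (1 + M + (floor_sqrt (m * N) + 2) * M)"
      using L by (intro add_left_mono mult_left_mono) (auto simp del: of_nat_add of_nat_mult)
    finally show "\<bar>pair_nth (\<Sum>k<N. (shift_feed ^^ (m * k)) x) p\<bar> \<le> \<dots>" .
  qed
  with that show thesis by blast
qed

lemma floor_sqrt_le_sqrt: "real (floor_sqrt n) \<le> sqrt (real n)"
  by (intro real_le_rsqrt) (metis floor_sqrt_power2_le of_nat_le_iff of_nat_power)

lemma mean_ergodic_funpow_shift_feed:
  assumes "0 < m"
  shows "mean_ergodic (shift_feed ^^ m)"
  unfolding mean_ergodic_def
proof (intro conjI allI)
  fix x
  define C where "C N = (1 / real N) *\<^sub>R (\<Sum>k<N. ((shift_feed ^^ m) ^^ k) x)" for N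
  have "C \<longlonglongrightarrow> 0"
  proof (rule tendstoI)
    fix e :: real assume e: "0 < e"
    then obtain M where M: "\<And>N. norm (\<Sum>k<N. (shift_feed ^^ (m * k)) x)
      \<le> 2 * (e / 4) * N + 2 * norm x * (1 + M + (floor_sqrt (m * N) + 2) * M)"
      using norm_cesaro_shift_feed_le[of "e / 4" m x] assms by auto
    \<comment> \<open>\<open>a\<close> collects the constant terms, with
      \<open>1 + M + 2 * M = 1 + 3 * M\<close>; \<open>b\<close> is the coefficient of
      \<open>sqrt N\<close>.\<close>
    define a b where "a = 2 * norm x * (1 + 3 * M)" and "b = 2 * norm x * M * sqrt m"
    have "(\<lambda>N. a * (1 / real N) + b * inverse (sqrt (real N))) \<longlonglongrightarrow> a * 0 + b * 0"
      by (intro tendsto_intros lim_1_over_n tendsto_inverse_0_at_top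
          filterlim_compose[OF sqrt_at_top filterlim_real_sequentially])
    then have "\<forall>\<^sub>F N in sequentially. a * (1 / real N) + b * inverse (sqrt (real N)) < e / 2"
      using e by (intro order_tendstoD) auto
    then show "\<forall>\<^sub>F N in sequentially. dist (C N) 0 < e"
      using eventually_gt_at_top[of 0]
    proof eventually_elim
      case (elim N)
      have "(2 * norm x * M) * real (floor_sqrt (m * N)) \<le> (2 * norm x * M) * (sqrt m * sqrt N)"
        using floor_sqrt_le_sqrt[of "m * N"] by (intro mult_left_mono) (simp_all add: real_sqrt_mult)
      then have "norm (\<Sum>k<N. (shift_feed ^^ (m * k)) x) \<le> e / 2 * N + (a + b * sqrt N)"
        using M[of N] by (simp add: a_def b_def algebra_simps)
      moreover have "norm (C N) = norm (\<Sum>k<N. (shift_feed ^^ (m * k)) x) / N"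
        by (simp add: C_def funpow_mult mult.commute)
      ultimately have "norm (C N) \<le> (e / 2 * N + (a + b * sqrt N)) / N"
        by (simp add: divide_right_mono)
      also have "\<dots> = e / 2 + (a * (1 / real N) + b * inverse (sqrt (real N)))"
        using elim sqrt_divide_self_eq[of "real N"]
        unfolding add_divide_distrib times_divide_eq_right[symmetric] by simp
      also have "\<dots> < e"
        using elim by linarith
      finally show ?case by simp
    qed
  qed
  then show "convergent (\<lambda>n. (1 / real n) *\<^sub>R (\<Sum>k<n. ((shift_feed ^^ m) ^^ k) x))"
    unfolding C_def by (rule convergentI)
qed (rule bounded_linear_funpow_shift_feed)

section \<open>Failure of weak almost periodicity\<close>

text \<open>The weakly open sets \<open>U r\<close> cover everything, as no null sequence is 1 on
  the infinite range of \<open>h\<close>; any finite subfamily misses some \<open>y\<close> in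
  \<open>S\<close>.\<close>

lemma not_relatively_weakly_compactI:
  fixes S :: "c0 set" and h :: "nat \<Rightarrow> nat"
  assumes "inj h" and S: "\<And>K. \<exists>y\<in>S. \<forall>r\<le>K. c0_nth y (h r) = 1"
  shows "\<not> relatively_weakly_compact S"
proof
  define U where "U r = (\<lambda>z. c0_nth z (h r)) -` (- {1})" for r
  assume "relatively_weakly_compact S"
  then have comp: "compactin weak_topology (weak_topology closure_of S)"
    by (simp add: relatively_weakly_compact_def)
  have "bounded_linear (\<lambda>z. c0_nth z n)" for n
    by (rule bounded_linear_intro[where K = 1]) (simp_all add: abs_c0_nth_le_norm)
  moreover have "open (- {1::real})"
    by (rule open_Compl) simp
  ultimately have "openin weak_topology (U r)" for r
    unfolding weak_topology_def U_def
    by (intro openin_topology_generated_by_iff[THEN iffD2] generate_topology_on.Basis) blast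
  then have openU: "openin weak_topology V" if "V \<in> range U" for V
    using that by blast
  have "z \<in> \<Union> (range U)" for z
  proof (rule ccontr)
    assume "z \<notin> \<Union> (range U)"
    then have "range h \<subseteq> {n. 1 \<le> \<bar>c0_nth z n\<bar>}"
      by (auto simp: U_def)
    moreover have "finite {n. 1 \<le> \<bar>c0_nth z n\<bar>}"
      using c0_nth_tendsto[of z] tendsto_zero_iff_finite by (metis zero_less_one)
    ultimately have "finite (range h)"
      by (rule finite_subset)
    then show False
      using range_inj_infinite[OF assms(1)] by contradiction
  qed
  then have "weak_topology closure_of S \<subseteq> \<Union> (range U)"
    by blast
  from compactinD[OF comp _ this] openU obtain \<F> where \<F>: "finite \<F>" "\<F> \<subseteq> range U"
      and cover: "weak_topology closure_of S \<subseteq> \<Union> \<F>"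
    by metis
  from finite_subset_image[OF \<F>] obtain F where F: "finite F" "\<F> = U ` F"
    by (elim exE conjE)
  obtain K where K: "\<forall>r\<in>F. r \<le> K"
    using F(1) finite_nat_set_iff_bounded_le by blast
  obtain y where "y \<in> S" and y: "\<forall>r\<le>K. c0_nth y (h r) = 1"
    using S by blast
  then have "y \<in> weak_topology closure_of S"
    using closure_of_subset[of S weak_topology] by auto
  then show False
    using cover F(2) K y by (auto simp: U_def)
qed

text \<open>Just before a square the whole block \<open>K\<close> has been traversed, so all
  \<open>2 * K + 1\<close> portions are present.\<close>

lemma feed_coeff_full:
  assumes "r \<le> K"
  shows "feed_coeff r 0 ((Suc K)\<^sup>2 - 1) = 1"
proof -
  have q: "floor_sqrt ((Suc K)\<^sup>2 - 1) = K"
    by (simp add: floor_sqrt_eq_iff power2_eq_square)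
  have "{p\<in>{0..(Suc K)\<^sup>2 - 1}. floor_sqrt p = K} = {p. floor_sqrt p = K}"
    by (auto simp: floor_sqrt_eq_iff)
  then show ?thesis
    using assms unfolding feed_coeff_def q by (simp add: card_floor_sqrt_eq)
qed

lemma not_weakly_almost_periodic_shift_feed: "\<not> weakly_almost_periodic shift_feed"
proof -
  define x where "x = of_pairs (\<lambda>p. of_bool (p = (0, 0)))"
  have x: "pair_nth x = (\<lambda>p. of_bool (p = (0, 0)))"
    unfolding x_def
  proof (rule pair_nth_of_pairs)
    fix e :: real assume "0 < e"
    then have "{p. e \<le> \<bar>of_bool (p = (0::nat, 0::nat))\<bar>} \<subseteq> {(0, 0)}"
      by auto
    then show "finite {p. e \<le> \<bar>of_bool (p = (0::nat, 0::nat))\<bar>}"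
      by (rule finite_subset) simp
  qed
  have "\<not> relatively_weakly_compact {(shift_feed ^^ n) x | n. n \<ge> 1}"
  proof (rule not_relatively_weakly_compactI)
    \<comment> \<open>\<open>Suc r\<close> skips row 0, the delay line.\<close>
    show "inj (\<lambda>r. prod_encode (Suc r, 0))"
      by (simp add: inj_def)
    fix K
    \<comment> \<open>\<open>Suc n\<close> is a square and \<open>n\<close> lies in block
      \<open>Suc K\<close>, so all rows \<open>Suc r\<close> with \<open>r \<le> K\<close> have been
      fed in full and gap 0 hits the support of \<open>x\<close>.\<close>
    define n where "n = (Suc (Suc K))\<^sup>2 - 1"
    have "floor_sqrt n = Suc K"
      by (simp add: n_def floor_sqrt_eq_iff power2_eq_square)
    then have "square_gap n = 0"
      by (simp add: square_gap_def n_def)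
    then have "c0_nth ((shift_feed ^^ Suc n) x) (prod_encode (Suc r, 0)) = 1" if "r \<le> K" for r
      using pair_nth_funpow_Suc[of "Suc r" n x 0] feed_coeff_full[of "Suc r" "Suc K"] that
      by (simp add: x n_def pair_nth_def[symmetric] del: funpow.simps)
    then show "\<exists>y\<in>{(shift_feed ^^ n) x | n. n \<ge> 1}.
        \<forall>r\<le>K. c0_nth y (prod_encode (Suc r, 0)) = 1"
      by (intro bexI[of _ "(shift_feed ^^ Suc n) x"]) (blast, use le_add1 in force)
  qed
  then show ?thesis
    unfolding weakly_almost_periodic_def by blast
qed

section \<open>The example\<close>

theorem mainTheorem3:
  "\<exists>T :: c0 \<Rightarrow> c0.
     positive_operator T \<and> bounded_linear T \<and>
     (\<forall>n\<ge>1. onorm (T ^^ n) \<le> 4) \<and>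
     (\<forall>m\<ge>1. mean_ergodic (T ^^ m)) \<and>
     \<not> weakly_almost_periodic T"
proof (intro exI[of _ shift_feed] conjI allI impI)
  show "bounded_linear shift_feed"
    using bounded_linear_funpow_shift_feed[of 1] by simp
  show "onorm (shift_feed ^^ n) \<le> 4" for n
  proof (rule onorm_bound)
    show "norm ((shift_feed ^^ n) x) \<le> 4 * norm x" for x
      using norm_funpow_shift_feed_le[of n x] norm_ge_zero[of x] by linarith
  qed simp
qed (simp_all add: positive_operator_shift_feed mean_ergodic_funpow_shift_feed
    not_weakly_almost_periodic_shift_feed)

end
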